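(* There is a convex instance $I=(S,\{t\},(\infty,\infty,\infty),0)$ of FLaMECaST (one intermediate layer, a single sink $t$, unlimited capacities, $\alpha=0$) such that every minimum-cost layout of $I$ contains a Steiner vertex that is not $2$-consecutive with respect to the cyclic ordering of the sources (regardless of how this ordering is chosen).
   Context: FLaMECaST: an instance $I=(S,T,C,\alpha)$ consists of a finite set $S$ of sources and a finite set $T$ of sinks, each with a fixed position in $\mathbb{R}^2$ (several sources may share a position), capacities $C=(c_0,\dots,c_{\lambda+1})$ ($\lambda$ = number of intermediate layers; here $\lambda=1$ and all capacities are $\infty$, i.e., no capacity constraints), and $\alpha\in[0,1]$. A layout consists of a rooted forest (edges directed from child to parent) of height at most $\lambda+1$ whose leaves are exactly $S$ and whose roots lie in $T$ (other vertices are Steiner vertices), together with an embedding mapping sources and sinks to their positions and Steiner vertices to arbitrary points of $\mathbb{R}^2$. The cost of an edge $uv$ ($u$ child of $v$) is $\|\mathrm{pos}(u)-\mathrm{pos}(v)\|\cdot\ell(uv)^\alpha$, where $\ell(uv)$ is the number of sources in the subtree of $u$; for $\alpha=0$ this is just the edge length. The cost of a layout is the sum of its edge costs. An instance is convex if all sources lie on the boundary of the convex hull of $S\cup T$; the cyclic ordering of the sources is the counterclockwise order along this boundary (co-located sources ordered arbitrarily). A Steiner vertex is $k$-consecutive with respect to an ordering if its children can be partitioned into at most $k$ sequences of sources that are consecutive in that ordering. *)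

theory Defs
  imports
    "HOL-Complex_Analysis.Winding_Numbers"
    "HOL-Library.Extended_Nat"
    "HOL-Library.Disjoint_Sets"
begin

text \<open>The plane is modelled by the type of complex numbers. Sources, sinks and Steiner vertices
  are named by natural numbers; several sources may have the same position.\<close>

datatype node = Source nat | Sink nat | Steiner nat

record flamecast =
  sources :: "nat set"
  sinks :: "nat set"
  source_pos :: "nat \<Rightarrow> complex"
  sink_pos :: "nat \<Rightarrow> complex"
  capacities :: "enat list"
  alpha :: real

text \<open>The capacities are listed as \<open>c\<^sub>0, \<dots>, c\<^bsub>\<lambda>+1\<^esub>\<close>, so their number determines \<open>\<lambda>\<close>.\<close>

definition num_layers :: "flamecast \<Rightarrow> nat" where
  "num_layers I = length (capacities I) - 2"

definition valid_instance :: "flamecast \<Rightarrow> bool" where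
  "valid_instance I \<longleftrightarrow>
     finite (sources I) \<and> finite (sinks I) \<and> 2 \<le> length (capacities I) \<and>
     0 \<le> alpha I \<and> alpha I \<le> 1"

text \<open>An edge is a pair (child, parent).\<close>

record layout =
  verts :: "node set"
  edges :: "(node \<times> node) set"
  emb :: "node \<Rightarrow> complex"

definition rooted_forest :: "node set \<Rightarrow> (node \<times> node) set \<Rightarrow> bool" where
  "rooted_forest V E \<longleftrightarrow> finite V \<and> E \<subseteq> V \<times> V \<and> single_valued E \<and> acyclic E"

definition leaves :: "layout \<Rightarrow> node set" where
  "leaves L = {v \<in> verts L. \<nexists>u. (u, v) \<in> edges L}"

definition roots :: "layout \<Rightarrow> node set" where
  "roots L = {v \<in> verts L. \<nexists>w. (v, w) \<in> edges L}"

definition children :: "layout \<Rightarrow> node \<Rightarrow> node set" where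
  "children L v = {u. (u, v) \<in> edges L}"

definition node_height :: "layout \<Rightarrow> node \<Rightarrow> nat" where
  "node_height L v = Max {n. \<exists>u. (u, v) \<in> edges L ^^ n}"

definition load :: "layout \<Rightarrow> node \<Rightarrow> nat" where
  "load L v = card {s. Source s \<in> verts L \<and> (Source s, v) \<in> (edges L)\<^sup>*}"

text \<open>Capacity \<open>c\<^sub>i\<close> bounds the number of sources below a vertex of height \<open>i\<close>.\<close>

definition is_layout :: "flamecast \<Rightarrow> layout \<Rightarrow> bool" where
  "is_layout I L \<longleftrightarrow>
     rooted_forest (verts L) (edges L) \<and>
     leaves L = Source ` sources I \<and>
     roots L \<subseteq> Sink ` sinks I \<and>
     verts L - leaves L - roots L \<subseteq> range Steiner \<and>
     (\<forall>v\<in>verts L. node_height L v \<le> num_layers I + 1) \<and>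
     (\<forall>v\<in>verts L. enat (load L v) \<le> capacities I ! node_height L v) \<and>
     (\<forall>s\<in>sources I. emb L (Source s) = source_pos I s) \<and>
     (\<forall>t\<in>sinks I. emb L (Sink t) = sink_pos I t)"

definition layout_cost :: "flamecast \<Rightarrow> layout \<Rightarrow> real" where
  "layout_cost I L =
     (\<Sum>(u, v)\<in>edges L. norm (emb L u - emb L v) * real (load L u) powr alpha I)"

definition min_cost_layout :: "flamecast \<Rightarrow> layout \<Rightarrow> bool" where
  "min_cost_layout I L \<longleftrightarrow> is_arg_min (layout_cost I) (is_layout I) L"

definition instance_hull :: "flamecast \<Rightarrow> complex set" where
  "instance_hull I = convex hull (source_pos I ` sources I \<union> sink_pos I ` sinks I)"

definition convex_instance :: "flamecast \<Rightarrow> bool" where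
  "convex_instance I \<longleftrightarrow> (\<forall>s\<in>sources I. source_pos I s \<in> frontier (instance_hull I))"

text \<open>A counterclockwise traversal of the boundary of a convex polygon. A polygon that degenerates
  to a segment (or a point) is traversed along the segment and back, so that a cyclic ordering
  of the sources exists in this case as well.\<close>

definition ccw_boundary :: "complex set \<Rightarrow> (real \<Rightarrow> complex) \<Rightarrow> bool" where
  "ccw_boundary K g \<longleftrightarrow>
     (if interior K \<noteq> {}
      then simple_path g \<and> pathfinish g = pathstart g \<and> path_image g = frontier K \<and>
           (\<forall>z\<in>interior K. winding_number g z = 1)
      else (\<exists>a b. K = closed_segment a b \<and> g = linepath a b +++ linepath b a))"

text \<open>The list is to be read cyclically; co-located sources may share a parameter and can
  therefore be listed in any order.\<close>

definition cyclic_ordering :: "flamecast \<Rightarrow> nat list \<Rightarrow> bool" where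
  "cyclic_ordering I xs \<longleftrightarrow>
     distinct xs \<and> set xs = sources I \<and>
     (\<exists>g us. ccw_boundary (instance_hull I) g \<and> sorted us \<and> set us \<subseteq> {0..1} \<and>
             map g us = map (source_pos I) xs)"

definition consecutive :: "nat list \<Rightarrow> node set \<Rightarrow> bool" where
  "consecutive xs Q \<longleftrightarrow> (\<exists>n m. Q = Source ` set (take m (rotate n xs)))"

definition k_consecutive :: "nat \<Rightarrow> nat list \<Rightarrow> layout \<Rightarrow> node \<Rightarrow> bool" where
  "k_consecutive k xs L v \<longleftrightarrow>
     (\<exists>P. partition_on (children L v) P \<and> finite P \<and> card P \<le> k \<and> (\<forall>Q\<in>P. consecutive xs Q))"

end

theory Submission
  imports Defs
begin

text \<open>The sources are placed on the boundary of the triangle with corners \<open>1\<close>, \<open>-1\<close>, \<open>\<i>\<close>, and the sink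
  is at \<open>\<i>\<close>. There are 500 sources at each of the corners \<open>1\<close> and \<open>-1\<close>, one source at \<open>\<i>\<close>, and one
  source at the midpoint of each side. The crowded corners force every cheap layout to have a
  Steiner vertex within distance \<open>1/100\<close> of \<open>1\<close> and another one within \<open>1/100\<close> of \<open>-1\<close>. Joining the
  three midpoints in a Steiner vertex at \<open>\<i> / 2\<close> yields total cost \<open>2 + 2 * sqrt 2\<close>, of which at most
  \<open>2 + 2/100\<close> remains for the midpoints once the two corners are paid for. Every way of connecting the
  midpoints other than by a common Steiner vertex, which does not also serve the source at \<open>\<i>\<close>,
  exceeds this remainder. This vertex is not 2-consecutive: two of the
  midpoints would lie in one block, hence in a connected part of the boundary that
  avoids all three corners, although they lie on different sides.\<close>

section \<open>Heights, parents and cost in layouts with one intermediate layer\<close>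

text \<open>Makes the \<open>Max\<close> in \<open>node_height\<close> meaningful. Well-founded
  induction along the edges: a nonempty path into \<open>v\<close> is a path into some child of
  \<open>v\<close>, extended by one edge.\<close>

lemma finite_path_lengths:
  assumes "finite E" "acyclic E"
  shows "finite {n. \<exists>u. (u, v) \<in> E ^^ n}"
proof -
  have "wf E" using assms by (rule finite_acyclic_wf)
  then show ?thesis
  proof (induction v rule: wf_induct_rule)
    case (less v)
    have "{n. \<exists>u. (u, v) \<in> E ^^ n} \<subseteq> {0} \<union> (\<Union>w\<in>{w. (w, v) \<in> E}. Suc ` {n. \<exists>u. (u, w) \<in> E ^^ n})"
    proof
      fix n assume "n \<in> {n. \<exists>u. (u, v) \<in> E ^^ n}"
      then show "n \<in> {0} \<union> (\<Union>w\<in>{w. (w, v) \<in> E}. Suc ` {n. \<exists>u. (u, w) \<in> E ^^ n})"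
        by (cases n) auto
    qed
    moreover have "finite {w. (w, v) \<in> E}"
      using finite_subset[of "{w. (w, v) \<in> E}" "fst ` E"] assms(1) by force
    ultimately show ?case
      using less by (elim finite_subset) simp
  qed
qed

lemma relpow_le_node_height:
  assumes "is_layout I L" "(u, v) \<in> edges L ^^ n"
  shows "n \<le> node_height L v"
proof -
  have "finite (edges L)" "acyclic (edges L)"
    using assms(1) unfolding is_layout_def rooted_forest_def
    by (auto intro: finite_subset[OF _ finite_cartesian_product])
  then show ?thesis
    unfolding node_height_def using assms(2) by (intro Max_ge finite_path_lengths) auto
qed

text \<open>If the grandparent of a source were not the sink, it would have a parent itself, and the
  path of length 3 from the source would exceed the maximal height 2.\<close>

lemma source_parent:
  assumes L: "is_layout I L" and "num_layers I = 1" "sinks I = {t}" "s \<in> sources I"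
  obtains v where "(Source s, v) \<in> edges L"
    "v = Sink t \<or> v \<in> range Steiner \<and> (v, Sink t) \<in> edges L"
proof -
  have sub: "edges L \<subseteq> verts L \<times> verts L" and lv: "leaves L = Source ` sources I"
    and rt: "roots L \<subseteq> {Sink t}" and st: "verts L - leaves L - roots L \<subseteq> range Steiner"
    and ht: "\<And>v. v \<in> verts L \<Longrightarrow> node_height L v \<le> 2"
    using L assms(2,3) unfolding is_layout_def rooted_forest_def by auto
  have up: "v = Sink t \<or> v \<in> range Steiner" if "(u, v) \<in> edges L" for u v
    using that sub rt st unfolding leaves_def by auto
  have out: "\<exists>w. (v, w) \<in> edges L" if "v \<in> verts L" "v \<noteq> Sink t" for v
    using that rt unfolding roots_def by auto
  have "Source s \<in> verts L" using lv assms(4) unfolding leaves_def by auto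
  then obtain v where v: "(Source s, v) \<in> edges L" using out by blast
  show ?thesis
  proof (cases "v = Sink t")
    case True
    with v that show ?thesis by blast
  next
    case False
    then obtain w where w: "(v, w) \<in> edges L" using out v sub by blast
    have "w = Sink t"
    proof (rule ccontr)
      assume "w \<noteq> Sink t"
      then obtain z where z: "(w, z) \<in> edges L" using out w sub by blast
      have "(Source s, z) \<in> edges L ^^ 3"
        using v w z by (auto simp: numeral_3_eq_3)
      then have "3 \<le> node_height L z" by (rule relpow_le_node_height[OF L])
      then show False using ht[of z] z sub by auto
    qed
    then show ?thesis using that v w up[OF v] False by blast
  qed
qed

text \<open>Needed because \<open>0 powr 0 = 0\<close> in HOL: for \<alpha> = 0 the load factor of
  an edge equals 1 only if the load is positive.\<close>

lemma load_pos:
  assumes L: "is_layout I L" and "s \<in> sources I" "(Source s, v) \<in> (edges L)\<^sup>*"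
  shows "load L v > 0"
proof -
  have "Source s \<in> verts L" "finite (verts L)"
    using L assms(2) unfolding is_layout_def rooted_forest_def leaves_def by auto
  moreover from this(2) have "finite {s. Source s \<in> verts L}"
    by (rule finite_vimageI[where h = Source, unfolded vimage_def]) (simp add: inj_def)
  ultimately show ?thesis
    unfolding load_def using assms(3) by (auto simp: card_gt_0_iff)
qed

text \<open>Counts the edge above each source, and for each Steiner vertex used as a parent its edge
  to the sink, once however many sources share it. Other edges have nonnegative cost.\<close>

lemma two_level_cost_ge:
  assumes L: "is_layout I L" and a: "alpha I = 0" and S: "sinks I = {t}" "finite (sources I)"
    and par: "\<And>s. s \<in> sources I \<Longrightarrow> (Source s, par s) \<in> edges L"
      "\<And>s. s \<in> sources I \<Longrightarrow> par s = Sink t \<or> par s \<in> range Steiner \<and> (par s, Sink t) \<in> edges L"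
  shows "(\<Sum>s\<in>sources I. norm (source_pos I s - emb L (par s)))
       + (\<Sum>f\<in>par ` sources I - {Sink t}. norm (emb L f - sink_pos I t)) \<le> layout_cost I L"
proof -
  define A where "A = (\<lambda>s. (Source s, par s)) ` sources I"
  define B where "B = (\<lambda>f. (f, Sink t)) ` (par ` sources I - {Sink t})"
  define c where "c = (\<lambda>(u, v). norm (emb L u - emb L v) * real (load L u) powr alpha I)"
  have fin: "finite (edges L)"
    using L unfolding is_layout_def rooted_forest_def
    by (auto intro: finite_subset[OF _ finite_cartesian_product])
  have sub: "A \<union> B \<subseteq> edges L" using par unfolding A_def B_def by blast
  have disj: "A \<inter> B = {}" using par(2) unfolding A_def B_def by fastforce
  have la: "load L (Source s) \<noteq> 0" if "s \<in> sources I" for s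
    using load_pos[OF L that, of "Source s"] by simp
  have lb: "load L (par s) > 0" if "s \<in> sources I" for s
    using load_pos[OF L that] par(1)[OF that] by blast
  have emb: "\<And>s. s \<in> sources I \<Longrightarrow> emb L (Source s) = source_pos I s"
    "emb L (Sink t) = sink_pos I t"
    using L S unfolding is_layout_def by auto
  have "sum c A = (\<Sum>s\<in>sources I. norm (source_pos I s - emb L (par s)))"
  proof -
    have "sum c A = (\<Sum>s\<in>sources I. c (Source s, par s))"
      unfolding A_def by (subst sum.reindex) (auto simp: inj_on_def)
    also have "\<dots> = (\<Sum>s\<in>sources I. norm (source_pos I s - emb L (par s)))"
    proof (rule sum.cong)
      fix s assume s: "s \<in> sources I"
      show "c (Source s, par s) = norm (source_pos I s - emb L (par s))"
        using la[OF s] by (simp add: c_def a emb s)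
    qed simp
    finally show ?thesis .
  qed
  moreover have "sum c B = (\<Sum>f\<in>par ` sources I - {Sink t}. norm (emb L f - sink_pos I t))"
  proof -
    have "sum c B = (\<Sum>f\<in>par ` sources I - {Sink t}. c (f, Sink t))"
      unfolding B_def by (subst sum.reindex) (auto simp: inj_on_def)
    also have "\<dots> = (\<Sum>f\<in>par ` sources I - {Sink t}. norm (emb L f - sink_pos I t))"
    proof (rule sum.cong)
      fix f assume "f \<in> par ` sources I - {Sink t}"
      then have "load L f > 0" using lb by auto
      then show "c (f, Sink t) = norm (emb L f - sink_pos I t)"
        by (simp add: c_def a emb)
    qed simp
    finally show ?thesis .
  qed
  moreover have "sum c A + sum c B = sum c (A \<union> B)"
    using disj S(2) by (subst sum.union_disjoint) (auto simp: A_def B_def)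
  moreover have "sum c (A \<union> B) \<le> sum c (edges L)"
    using sub fin by (intro sum_mono2) (auto simp: c_def)
  ultimately show ?thesis unfolding layout_cost_def c_def by simp
qed

text \<open>Cauchy-Schwarz with a vector of norm at most 1. It turns lower bounds on sums of
  distances into linear arithmetic: choose vectors for which the unknown point \<open>z\<close>
  cancels.\<close>

lemma inner_le_cmod:
  assumes "a\<^sup>2 + b\<^sup>2 \<le> 1"
  shows "a * (Re p - Re z) + b * (Im p - Im z) \<le> cmod (p - z)"
proof -
  let ?x = "Re p - Re z" and ?y = "Im p - Im z"
  have "(a * ?x + b * ?y)\<^sup>2 \<le> (a\<^sup>2 + b\<^sup>2) * (?x\<^sup>2 + ?y\<^sup>2)"
    using zero_le_power2[of "a * ?y - b * ?x"] by (simp add: power2_eq_square algebra_simps)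
  also have "\<dots> \<le> 1 * (?x\<^sup>2 + ?y\<^sup>2)" using assms by (intro mult_right_mono) auto
  finally show ?thesis unfolding cmod_def by (simp add: real_le_rsqrt)
qed

section \<open>Blocks of a cyclic ordering and connected parts of a closed curve\<close>

text \<open>A block is an arc of the cyclic list, so with two entries it contains everything on one
  of the two sides between them.\<close>

lemma cyclic_block_between_or_around:
  fixes xs :: "'a list"
  assumes ij: "i < j" "j < length xs" "xs ! i \<in> set (take m (rotate n xs))" "xs ! j \<in> set (take m (rotate n xs))"
    and "distinct xs"
  shows "(\<forall>k. i < k \<and> k < j \<longrightarrow> xs ! k \<in> set (take m (rotate n xs))) \<or>
         (\<forall>k<length xs. k < i \<or> j < k \<longrightarrow> xs ! k \<in> set (take m (rotate n xs)))"
proof -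
  define r where "r = n mod length xs"
  have len: "length xs > 0" using ij by auto
  then have r: "r < length xs" unfolding r_def by simp
  have md: "a mod length xs = (if a < length xs then a else a - length xs)" if "a < 2 * length xs" for a
    using that by (simp add: le_mod_geq)
  \<comment> \<open>Rotation by \<open>r\<close> moves position \<open>k\<close> to
    \<open>k - r\<close>, modulo the length of the list, and the block consists of the first
    \<open>m\<close> positions.\<close>
  have iff: "xs ! k \<in> set (take m (rotate n xs)) \<longleftrightarrow> (if r \<le> k then k - r < m else k + length xs - r < m)"
    (is "_ \<longleftrightarrow> ?R") if k: "k < length xs" for k
  proof
    assume "xs ! k \<in> set (take m (rotate n xs))"
    then obtain l where l: "l < m" "l < length xs" "rotate n xs ! l = xs ! k"
      by (auto simp: in_set_conv_nth)
    then have "xs ! ((n + l) mod length xs) = xs ! k" by (simp add: nth_rotate)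
    then have "(n + l) mod length xs = k"
      using nth_eq_iff_index_eq[OF assms(5)] k len by simp
    then have "(r + l) mod length xs = k" unfolding r_def by (simp add: mod_add_left_eq)
    then show ?R using l r by (auto simp: md split: if_splits)
  next
    assume R: ?R
    define l where "l = (if r \<le> k then k - r else k + length xs - r)"
    have "(n + l) mod length xs = (r + l) mod length xs" unfolding r_def by (simp add: mod_add_left_eq)
    also have "\<dots> = k" using k r unfolding l_def by (auto simp: md)
    finally have eq: "(n + l) mod length xs = k" .
    have l: "l < m" "l < length xs" using R k r unfolding l_def by (auto split: if_splits)
    then have "rotate n xs ! l = xs ! k" using eq by (simp add: nth_rotate)
    with l show "xs ! k \<in> set (take m (rotate n xs))"
      unfolding in_set_conv_nth by (intro exI[of _ l]) auto
  qed
  have "i < length xs" using ij by simp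
  then have "if r \<le> i then i - r < m else i + length xs - r < m"
    "if r \<le> j then j - r < m else j + length xs - r < m" using ij iff by blast+
  note ij' = this
  show ?thesis
  \<comment> \<open>Unless the start \<open>r\<close> of the block satisfies
    \<open>i < r \<le> j\<close>, the block reaches \<open>j\<close> from \<open>i\<close> without
    wrapping; otherwise it runs from \<open>j\<close> past the end of the list to
    \<open>i\<close>.\<close>
  proof (cases "r \<le> i \<or> j < r")
    case True
    have "xs ! k \<in> set (take m (rotate n xs))" if "i < k" "k < j" for k
      using iff[of k] that ij ij' True r by (auto split: if_splits)
    then show ?thesis by blast
  next
    case False
    have "xs ! k \<in> set (take m (rotate n xs))" if "k < length xs" "k < i \<or> j < k" for k
      using iff[of k] that ij ij' False r by (auto split: if_splits)
    then show ?thesis by blast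
  qed
qed

text \<open>The set \<open>A\<close> is the part of the curve traced on the side from
  \<open>a\<close> to \<open>b\<close> that the block fills. Sources outside the block have
  parameters on the other side, and injectivity of \<open>g\<close> keeps them off \<open>A\<close>,
  unless they share the position of \<open>a\<close> or \<open>b\<close>.\<close>

lemma cyclic_block_connected:
  fixes p :: "'a \<Rightarrow> complex"
  assumes g: "simple_path g" "pathfinish g = pathstart g"
    and us: "sorted us" "set us \<subseteq> {0..1}" "map g us = map p xs" and "distinct xs"
    and ab: "a \<in> set (take m (rotate n xs))" "b \<in> set (take m (rotate n xs))"
  obtains A where "connected A" "A \<subseteq> path_image g" "p a \<in> A" "p b \<in> A"
    "\<And>c. c \<in> set xs \<Longrightarrow> c \<notin> set (take m (rotate n xs)) \<Longrightarrow> p c \<noteq> p a \<Longrightarrow> p c \<noteq> p b \<Longrightarrow> p c \<notin> A"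
proof -
  let ?B = "set (take m (rotate n xs))"
  let ?P = "\<lambda>a b. \<exists>A. connected A \<and> A \<subseteq> path_image g \<and> p a \<in> A \<and> p b \<in> A \<and>
    (\<forall>c\<in>set xs - ?B. p c \<noteq> p a \<longrightarrow> p c \<noteq> p b \<longrightarrow> p c \<notin> A)"
  have len: "length us = length xs" using us(3) by (metis length_map)
  have gu: "g (us ! k) = p (xs ! k)" "0 \<le> us ! k" "us ! k \<le> 1" if "k < length xs" for k
    using that len us(3) nth_map[of k us g] nth_map[of k xs p] subsetD[OF us(2) nth_mem[of k us]] by auto
  have mono: "us ! k \<le> us ! l" if "k \<le> l" "l < length xs" for k l
    using sorted_nth_mono[OF us(1) that(1)] that len by simp
  have cont: "continuous_on {0..1} g" using g(1) simple_path_imp_path path_def by blast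
  have g01: "g 0 = g 1" using g(2) by (simp add: pathfinish_def pathstart_def)
  have inj: "s = u \<or> s = 0 \<and> u = 1 \<or> s = 1 \<and> u = 0" if "g s = g u" "0 \<le> s" "s \<le> 1" "0 \<le> u" "u \<le> 1" for s u
    using g(1) that unfolding simple_path_def loop_free_def by auto
  have main: "?P (xs ! i) (xs ! j)"
    if ij: "i < j" "j < length xs" "xs ! i \<in> ?B" "xs ! j \<in> ?B" for i j
  proof -
    have i: "i < length xs" using ij by simp
    note gi = gu[OF i] and gj = gu[OF ij(2)]
    have le: "us ! i \<le> us ! j" using mono ij by simp
    consider "\<forall>k. i < k \<and> k < j \<longrightarrow> xs ! k \<in> ?B" | "\<forall>k<length xs. k < i \<or> j < k \<longrightarrow> xs ! k \<in> ?B"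
      using cyclic_block_between_or_around[OF ij \<open>distinct xs\<close>] by blast
    then show ?thesis
    proof cases
      case 1
      let ?A = "g ` {us ! i..us ! j}"
      have "connected ?A"
        using gi gj by (intro connected_continuous_image continuous_on_subset[OF cont]) auto
      moreover have "?A \<subseteq> path_image g" using gi gj by (auto simp: path_image_def)
      moreover have "p c \<notin> ?A" if c: "c \<in> set xs - ?B" "p c \<noteq> p (xs ! i)" "p c \<noteq> p (xs ! j)" for c
      proof
        assume "p c \<in> ?A"
        then obtain s where s: "us ! i \<le> s" "s \<le> us ! j" "p c = g s" by auto
        obtain k where k: "k < length xs" "xs ! k = c" using c by (auto simp: in_set_conv_nth)
        note gk = gu[OF k(1)]
        have "k \<le> i \<or> j \<le> k" using 1 c k by (meson DiffD2 not_le)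
        then have "us ! k \<le> us ! i \<or> us ! j \<le> us ! k" using mono i k by blast
        moreover have "s = us ! k \<or> s = 0 \<and> us ! k = 1 \<or> s = 1 \<and> us ! k = 0"
          using inj[of s "us ! k"] s gi gj gk k by auto
        \<comment> \<open>Sortedness keeps \<open>us ! k\<close> out of the open interval, so a
          point of \<open>A\<close> is hit only at its ends; the last two disjuncts are the
          identification of parameters 0 and 1.\<close>
        ultimately have "us ! k = us ! i \<or> us ! k = us ! j \<or> us ! i = 0 \<and> us ! k = 1 \<or> us ! j = 1 \<and> us ! k = 0"
          using s gi gj by linarith
        then show False using c gi gj gk k g01 by metis
      qed
      ultimately show ?thesis
        using le by (intro exI[of _ ?A]) (auto simp flip: gi(1) gj(1))
    next
      case 2
      let ?A = "g ` {0..us ! i} \<union> g ` {us ! j..1}"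
      have "connected (g ` {0..us ! i})" "connected (g ` {us ! j..1})"
        using gi gj by (auto intro!: connected_continuous_image continuous_on_subset[OF cont])
      \<comment> \<open>The two outer parameter intervals are glued at the common start and end of
        the closed curve.\<close>
      moreover have "g 0 \<in> g ` {0..us ! i}" "g 0 \<in> g ` {us ! j..1}"
        using gi gj by (simp, simp add: g01)
      ultimately have conn: "connected ?A" by (intro connected_Un) auto
      have sub: "?A \<subseteq> path_image g" using gi gj by (auto simp: path_image_def)
      have avoid: "p c \<notin> ?A" if c: "c \<in> set xs - ?B" "p c \<noteq> p (xs ! i)" "p c \<noteq> p (xs ! j)" for c
      proof
        assume "p c \<in> ?A"
        then obtain s where s': "s \<in> {0..us ! i} \<union> {us ! j..1}" "p c = g s" by blast
        then have s: "0 \<le> s" "s \<le> 1" "s \<le> us ! i \<or> us ! j \<le> s" "p c = g s"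
          using gi gj by auto
        obtain k where k: "k < length xs" "xs ! k = c" using c by (auto simp: in_set_conv_nth)
        note gk = gu[OF k(1)]
        have "i \<le> k \<and> k \<le> j" using 2 c k by (meson DiffD2 not_le)
        then have "us ! i \<le> us ! k" "us ! k \<le> us ! j" using mono ij k by auto
        moreover have "s = us ! k \<or> s = 0 \<and> us ! k = 1 \<or> s = 1 \<and> us ! k = 0"
          using inj[of s "us ! k"] s gk k by auto
        ultimately have "us ! k = us ! i \<or> us ! k = us ! j"
          using s gi gj by linarith
        then show False using c gi gj gk k by metis
      qed
      have "g (us ! i) \<in> ?A" by (rule UnI1, rule imageI) (simp add: gi(2))
      then have memi: "p (xs ! i) \<in> ?A" unfolding gi(1) .
      have "g (us ! j) \<in> ?A" by (rule UnI2, rule imageI) (simp add: gj(3))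
      then have memj: "p (xs ! j) \<in> ?A" unfolding gj(1) .
      show ?thesis
        by (intro exI[of _ ?A] conjI ballI impI conn sub memi memj avoid)
    qed
  qed
  have sub: "?B \<subseteq> set xs" using set_take_subset[of m "rotate n xs"] by simp
  then obtain i j where ij: "i < length xs" "xs ! i = a" "j < length xs" "xs ! j = b"
    using ab by (metis in_set_conv_nth subsetD)
  have "?P a b"
  proof (cases i j rule: linorder_cases)
    case less
    then show ?thesis using main[of i j] ij ab by auto
  next
    case equal
    have "p a \<in> path_image g" using gu[OF ij(1)] ij image_eqI[of "p a" g "us ! i" "{0..1}"]
      by (simp add: path_image_def)
    then show ?thesis using equal ij by (intro exI[of _ "{p a}"]) auto
  next
    case greater
    then show ?thesis using main[of j i] ij ab by blast
  qed
  then show ?thesis using that by auto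
qed

lemma connected_subset_of_three_closed:
  assumes "connected A" "closed S" "closed T" "closed U" "A \<subseteq> S \<union> T \<union> U"
    and "A \<inter> S \<inter> T = {}" "A \<inter> S \<inter> U = {}" "A \<inter> T \<inter> U = {}"
  shows "A \<subseteq> S \<or> A \<subseteq> T \<or> A \<subseteq> U"
proof -
  have "A \<inter> S = {} \<or> A \<inter> (T \<union> U) = {}"
    using connected_closedD[OF assms(1), of S "T \<union> U"] assms by auto
  moreover have "A \<inter> T = {} \<or> A \<inter> (S \<union> U) = {}"
    using connected_closedD[OF assms(1), of T "S \<union> U"] assms by auto
  ultimately show ?thesis using assms(5) by blast
qed

section \<open>The instance and the boundary of its hull\<close>

text \<open>Source 0 can be joined to the sink at no cost; its purpose is to separate sources 1 and
  2 in the cyclic ordering at the corner \<open>\<i>\<close>.\<close>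

definition src_pos :: "nat \<Rightarrow> complex" where
  "src_pos s = (if s = 0 then \<i> else if s = 1 then Complex (1/2) (1/2)
     else if s = 2 then Complex (-1/2) (1/2) else if s = 3 then 0
     else if s < 504 then 1 else -1)"

definition inst :: flamecast where
  "inst = \<lparr>sources = {..<1004}, sinks = {0}, source_pos = src_pos, sink_pos = (\<lambda>_. \<i>),
     capacities = [\<infinity>, \<infinity>, \<infinity>], alpha = 0\<rparr>"

lemma inst_simps [simp]:
  "sources inst = {..<1004}" "sinks inst = {0}" "source_pos inst = src_pos"
  "sink_pos inst t = \<i>" "capacities inst = [\<infinity>, \<infinity>, \<infinity>]" "alpha inst = 0" "num_layers inst = 1"
  by (simp_all add: inst_def num_layers_def)

lemma src_pos_simps [simp]:
  "src_pos 0 = \<i>" "src_pos 1 = Complex (1/2) (1/2)" "src_pos (Suc 0) = Complex (1/2) (1/2)"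
  "src_pos 2 = Complex (-1/2) (1/2)" "src_pos 3 = 0"
  "4 \<le> s \<Longrightarrow> s < 504 \<Longrightarrow> src_pos s = 1" "504 \<le> s \<Longrightarrow> src_pos s = -1"
  by (simp_all add: src_pos_def)

lemma midpoints_in_sides:
  "src_pos 1 \<in> closed_segment \<i> 1" "src_pos 2 \<in> closed_segment (-1) \<i>"
  "src_pos 3 \<in> closed_segment 1 (-1)"
  by (auto simp: in_segment complex_eq_iff intro!: exI[of _ "1/2"])

lemma src_pos_in_sides:
  "src_pos s \<in> closed_segment 1 (-1) \<union> closed_segment (-1) \<i> \<union> closed_segment \<i> 1"
  using midpoints_in_sides by (auto simp: src_pos_def split: if_splits)

lemma frontier_triangle:
  "frontier (convex hull {1, -1, \<i>}) = closed_segment 1 (-1) \<union> closed_segment (-1) \<i> \<union> closed_segment \<i> 1"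
  by (rule frontier_of_triangle) simp

lemma hull_inst: "instance_hull inst = convex hull {1, -1, \<i>}"
proof -
  have "src_pos s \<in> convex hull {1, -1, \<i>}" for s
  proof -
    have "frontier (convex hull {1, -1, \<i>}) \<subseteq> convex hull {1, -1, \<i>}"
      by (intro frontier_subset_closed compact_imp_closed compact_convex_hull) simp
    then show ?thesis using src_pos_in_sides[of s] frontier_triangle by auto
  qed
  moreover have "{1, -1, \<i>} \<subseteq> src_pos ` {..<1004}"
    using image_eqI[of 1 src_pos 4 "{..<1004}"] image_eqI[of "-1" src_pos 504 "{..<1004}"]
      image_eqI[of \<i> src_pos 0 "{..<1004}"] by simp
  ultimately show ?thesis
    unfolding instance_hull_def
    by (intro antisym hull_minimal hull_mono) (auto simp: hull_inc)
qed

text \<open>The degenerate branch of \<open>ccw_boundary\<close> would make the triangle a segment,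
  but its corners are not collinear. Hence \<open>g\<close> is a simple closed curve around the
  three sides.\<close>

lemma ccw_boundary_inst:
  assumes "ccw_boundary (instance_hull inst) g"
  shows "simple_path g" "pathfinish g = pathstart g"
    "path_image g = closed_segment 1 (-1) \<union> closed_segment (-1) \<i> \<union> closed_segment \<i> 1"
proof -
  have "convex hull {1, -1, \<i>} \<noteq> closed_segment a b" for a b
  proof
    assume eq: "convex hull {1, -1, \<i>} = closed_segment a b"
    have "{1, -1, \<i>} \<subseteq> closed_segment a b" unfolding eq[symmetric] by (rule hull_subset)
    then have "collinear {1, -1, \<i>}"
      using collinear_closed_segment collinear_subset by blast
    then obtain u where u: "\<And>x y. x \<in> {1, -1, \<i>} \<Longrightarrow> y \<in> {1, -1, \<i>} \<Longrightarrow> \<exists>c. x - y = c *\<^sub>R u"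
      unfolding collinear_def by blast
    obtain c d where "1 - (-1) = c *\<^sub>R u" "1 - \<i> = d *\<^sub>R u" using u[of 1 "-1"] u[of 1 \<i>] by auto
    then show False by (auto simp: complex_eq_iff)
  qed
  then have "interior (convex hull {1, -1, \<i>}) \<noteq> {}"
    using assms unfolding ccw_boundary_def hull_inst by (auto split: if_splits)
  then show "simple_path g" "pathfinish g = pathstart g"
    "path_image g = closed_segment 1 (-1) \<union> closed_segment (-1) \<i> \<union> closed_segment \<i> 1"
    using assms unfolding ccw_boundary_def hull_inst by (simp_all add: frontier_triangle)
qed

text \<open>The lines through the sides meet pairwise only in corners, so a connected set avoiding
  the corners stays on one line, and each line contains only one of the three midpoints.\<close>

lemma connected_in_triangle_boundary:
  assumes "connected A" "A \<subseteq> closed_segment 1 (-1) \<union> closed_segment (-1) \<i> \<union> closed_segment \<i> 1"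
    and "1 \<notin> A" "-1 \<notin> A" "\<i> \<notin> A" and "a \<in> {1, 2, 3}" "b \<in> {1, 2, 3}" "src_pos a \<in> A" "src_pos b \<in> A"
  shows "a = b"
proof -
  let ?S = "{z. Im z = 0}" and ?T = "{z. Im z - Re z = 1}" and ?U = "{z. Im z + Re z = 1}"
  have "A \<subseteq> ?S \<or> A \<subseteq> ?T \<or> A \<subseteq> ?U"
  proof (rule connected_subset_of_three_closed[OF assms(1)])
    show "closed ?S" "closed ?T" "closed ?U"
      by (intro closed_Collect_eq continuous_intros)+
    have "closed_segment 1 (-1) \<subseteq> ?S" "closed_segment (-1) \<i> \<subseteq> ?T" "closed_segment \<i> 1 \<subseteq> ?U"
      by (auto simp: in_segment)
    then show "A \<subseteq> ?S \<union> ?T \<union> ?U" using assms(2) by blast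
    have "z = -1" if "z \<in> ?S \<inter> ?T" for z using that by (auto simp: complex_eq_iff)
    then show "A \<inter> ?S \<inter> ?T = {}" using assms(4) by blast
    have "z = 1" if "z \<in> ?S \<inter> ?U" for z using that by (auto simp: complex_eq_iff)
    then show "A \<inter> ?S \<inter> ?U = {}" using assms(3) by blast
    have "z = \<i>" if "z \<in> ?T \<inter> ?U" for z using that by (auto simp: complex_eq_iff)
    then show "A \<inter> ?T \<inter> ?U = {}" using assms(5) by blast
  qed
  then show ?thesis using assms(6-9) by auto
qed

section \<open>Separation of the three midpoints in the cyclic ordering\<close>

lemma not_2_consecutive:
  assumes "cyclic_ordering inst xs"
    and ch: "Source 1 \<in> children L v" "Source 2 \<in> children L v" "Source 3 \<in> children L v" "Source 0 \<notin> children L v"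
    and s: "s \<in> {4..<504}" "Source s \<notin> children L v" and s': "s' \<in> {504..<1004}" "Source s' \<notin> children L v"
  shows "\<not> k_consecutive 2 xs L v"
proof
  assume "k_consecutive 2 xs L v"
  then obtain P where P: "partition_on (children L v) P" "finite P" "card P \<le> 2" "\<And>Q. Q \<in> P \<Longrightarrow> consecutive xs Q"
    unfolding k_consecutive_def by blast
  have "\<exists>Q\<in>P. Source k \<in> Q" if "k \<in> {1, 2, 3}" for k
    using P(1) ch(1-3) that unfolding partition_on_def by auto
  then obtain q where q: "\<And>k. k \<in> {1, 2, 3} \<Longrightarrow> q k \<in> P \<and> Source k \<in> q k" by metis
  \<comment> \<open>Pigeonhole: three midpoints are distributed over at most two blocks.\<close>
  have "\<not> inj_on q {1, 2, 3::nat}"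
  proof
    assume "inj_on q {1, 2, 3::nat}"
    then have "card {1, 2, 3::nat} \<le> card P"
      by (rule card_inj_on_le) (use q P(2) in blast)+
    then show False using P(3) by simp
  qed
  then obtain a b where ab: "a \<in> {1, 2, 3}" "b \<in> {1, 2, 3}" "a \<noteq> b" "q a = q b"
    unfolding inj_on_def by blast
  obtain m n where "q a = Source ` set (take m (rotate n xs))"
    using P(4) q[OF ab(1)] unfolding consecutive_def by blast
  note qa = this
  let ?B = "set (take m (rotate n xs))"
  have B: "a \<in> ?B" "b \<in> ?B" using q[OF ab(1)] q[OF ab(2)] ab(4) qa by auto
  have "q a \<subseteq> children L v" using P(1) q[OF ab(1)] unfolding partition_on_def by blast
  then have nB: "0 \<notin> ?B" "s \<notin> ?B" "s' \<notin> ?B" using ch(4) s(2) s'(2) unfolding qa by blast+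
  obtain g us where xs: "distinct xs" "set xs = {..<1004}" "ccw_boundary (instance_hull inst) g"
    "sorted us" "set us \<subseteq> {0..1}" "map g us = map src_pos xs"
    using assms(1) unfolding cyclic_ordering_def by auto
  note g = ccw_boundary_inst[OF xs(3)]
  obtain A where A: "connected A" "A \<subseteq> path_image g" "src_pos a \<in> A" "src_pos b \<in> A"
    "\<And>c. c \<in> set xs \<Longrightarrow> c \<notin> ?B \<Longrightarrow> src_pos c \<noteq> src_pos a \<Longrightarrow> src_pos c \<noteq> src_pos b \<Longrightarrow> src_pos c \<notin> A"
    using cyclic_block_connected[OF g(1,2) xs(4-6,1) B] by blast
  have pos: "src_pos 0 = \<i>" "src_pos s = 1" "src_pos s' = -1" using s s' by auto
  \<comment> \<open>No corner coincides with a midpoint, so the exception for shared positions in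
    \<open>A(5)\<close> does not arise and all three corners lie off \<open>A\<close>.\<close>
  have ne: "z \<noteq> src_pos k" if "k \<in> {1, 2, 3}" "z \<in> {1, -1, \<i>}" for k z
    using that by (auto simp: complex_eq_iff)
  have "src_pos c \<notin> A" if "c \<in> {0, s, s'}" for c
  proof (rule A(5))
    have "src_pos c \<in> {1, -1, \<i>}" using that pos by auto
    then show "src_pos c \<noteq> src_pos a" "src_pos c \<noteq> src_pos b" using ne ab by blast+
    show "c \<in> set xs" using that s(1) s'(1) unfolding xs(2) by auto
    show "c \<notin> ?B" using that nB by blast
  qed
  then have "src_pos 0 \<notin> A" "src_pos s \<notin> A" "src_pos s' \<notin> A" by blast+
  then have "a = b"
    using connected_in_triangle_boundary[OF A(1) _ _ _ _ ab(1,2) A(3,4)] A(2) g(3) pos by simp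
  then show False using ab by simp
qed

section \<open>Lower bounds on stars and the structure of cheap layouts\<close>

text \<open>The coefficients are rational approximations to the directions of the edges in optimal stars:
  unit vectors that sum to zero bound the cost of a star from below.\<close>

lemma star_ge:
  "7/10 \<le> cmod (src_pos 1 - z) + cmod (z - \<i>)"
  "7/10 \<le> cmod (src_pos 2 - z) + cmod (z - \<i>)"
  "1 \<le> cmod (src_pos 3 - z) + cmod (z - \<i>)"
  "1366/1000 \<le> cmod (src_pos 1 - z) + cmod (src_pos 2 - z) + cmod (z - \<i>)"
  "1366/1000 \<le> cmod (src_pos 1 - z) + cmod (src_pos 3 - z) + cmod (z - \<i>)"
  "1366/1000 \<le> cmod (src_pos 2 - z) + cmod (src_pos 3 - z) + cmod (z - \<i>)"
  "225/100 \<le> cmod (src_pos 0 - z) + cmod (src_pos 1 - z) + cmod (src_pos 2 - z) + cmod (src_pos 3 - z)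
     + cmod (z - \<i>)"
proof -
  note c = inner_le_cmod[of _ _ "src_pos 0" z] inner_le_cmod[of _ _ "src_pos 1" z]
    inner_le_cmod[of _ _ "src_pos 2" z] inner_le_cmod[of _ _ "src_pos 3" z] inner_le_cmod[of _ _ z \<i>]
  show "7/10 \<le> cmod (src_pos 1 - z) + cmod (z - \<i>)"
    using c(2)[of "7/10" "-7/10"] c(5)[of "7/10" "-7/10"] by (simp add: power2_eq_square algebra_simps add_divide_distrib diff_divide_distrib)
  show "7/10 \<le> cmod (src_pos 2 - z) + cmod (z - \<i>)"
    using c(3)[of "-7/10" "-7/10"] c(5)[of "-7/10" "-7/10"] by (simp add: power2_eq_square algebra_simps add_divide_distrib diff_divide_distrib)
  show "1 \<le> cmod (src_pos 3 - z) + cmod (z - \<i>)"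
    using c(4)[of 0 "-1"] c(5)[of 0 "-1"] by (simp add: power2_eq_square algebra_simps add_divide_distrib diff_divide_distrib)
  \<comment> \<open>Any two midpoints form with \<open>\<i>\<close> a right isosceles triangle with
    hypotenuse 1, whose Fermat star has length \<open>(1 + sqrt 3) / 2\<close>; the directions meet
    at 120 degrees and 866/1000 is just below \<open>sqrt 3 / 2\<close>.\<close>
  show "1366/1000 \<le> cmod (src_pos 1 - z) + cmod (src_pos 2 - z) + cmod (z - \<i>)"
    using c(2)[of "866/1000" "-1/2"] c(3)[of "-866/1000" "-1/2"] c(5)[of 0 "-1"]
    by (simp add: power2_eq_square algebra_simps add_divide_distrib diff_divide_distrib)
  show "1366/1000 \<le> cmod (src_pos 1 - z) + cmod (src_pos 3 - z) + cmod (z - \<i>)"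
    using c(2)[of 1 0] c(4)[of "-1/2" "-866/1000"] c(5)[of "1/2" "-866/1000"]
    by (simp add: power2_eq_square algebra_simps add_divide_distrib diff_divide_distrib)
  show "1366/1000 \<le> cmod (src_pos 2 - z) + cmod (src_pos 3 - z) + cmod (z - \<i>)"
    using c(3)[of "-1" 0] c(4)[of "1/2" "-866/1000"] c(5)[of "-1/2" "-866/1000"]
    by (simp add: power2_eq_square algebra_simps add_divide_distrib diff_divide_distrib)
  show "225/100 \<le> cmod (src_pos 0 - z) + cmod (src_pos 1 - z) + cmod (src_pos 2 - z)
     + cmod (src_pos 3 - z) + cmod (z - \<i>)"
    using c(1)[of 0 "8/10"] c(2)[of "95/100" "-3/10"] c(3)[of "-95/100" "-3/10"] c(4)[of 0 "-1"]
      c(5)[of 0 "-8/10"] by (simp add: power2_eq_square algebra_simps add_divide_distrib diff_divide_distrib)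
qed

text \<open>The value 7/10 approximates \<open>sqrt 2 / 2\<close>, half the length of a short side.
  These bounds handle midpoints attached to a vertex at or near a corner.\<close>

lemma corner_dist_ge:
  assumes "q \<in> {1, -1, \<i>}"
  shows "7/10 \<le> cmod (src_pos 1 - q)" "7/10 \<le> cmod (src_pos 2 - q)" "1 \<le> cmod (src_pos 3 - q)"
  using assms inner_le_cmod[of "7/10" "-7/10" "src_pos 1" q] inner_le_cmod[of "-7/10" "7/10" "src_pos 1" q]
    inner_le_cmod[of "7/10" "7/10" "src_pos 1" q] inner_le_cmod[of "-7/10" "-7/10" "src_pos 2" q]
    inner_le_cmod[of "7/10" "7/10" "src_pos 2" q] inner_le_cmod[of "-7/10" "7/10" "src_pos 2" q]
  by (auto simp: power2_eq_square)

text \<open>The budget 202/100 is below \<open>1366/1000 + 69/100\<close>, the least bound for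
  serving the midpoints through at least two different parents. So they share one parent.\<close>

lemma cheap_layout_structure:
  assumes L: "is_layout inst L" and cost: "layout_cost inst L \<le> 2 + 2 * sqrt 2"
  obtains i s s' where "Steiner i \<in> verts L"
    "Source 1 \<in> children L (Steiner i)" "Source 2 \<in> children L (Steiner i)" "Source 3 \<in> children L (Steiner i)"
    "Source 0 \<notin> children L (Steiner i)"
    "s \<in> {4..<504}" "Source s \<notin> children L (Steiner i)" "s' \<in> {504..<1004}" "Source s' \<notin> children L (Steiner i)"
proof -
  have "\<exists>v. (Source s, v) \<in> edges L \<and> (v = Sink 0 \<or> v \<in> range Steiner \<and> (v, Sink 0) \<in> edges L)"
    if "s < 1004" for s
    using source_parent[OF L, of 0 s] that by auto
  then obtain par where par: "\<And>s. s < 1004 \<Longrightarrow> (Source s, par s) \<in> edges L"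
    "\<And>s. s < 1004 \<Longrightarrow> par s = Sink 0 \<or> par s \<in> range Steiner \<and> (par s, Sink 0) \<in> edges L"
    by metis
  define d where "d s = cmod (src_pos s - emb L (par s))" for s
  define h where "h f = cmod (emb L f - \<i>)" for f
  let ?W = "par ` {..<1004} - {Sink 0}"
  have bound: "sum d {..<1004} + sum h ?W \<le> 2 + 2 * sqrt 2"
    using order_trans[OF two_level_cost_ge[OF L, of 0 par] cost] par by (simp add: d_def h_def)
  have d0: "d s \<ge> 0" and h0: "h f \<ge> 0" for s f by (simp_all add: d_def h_def)
  have sqrt2: "sqrt 2 < 3/2" by (rule real_less_lsqrt) (auto simp: power2_eq_square)
  \<comment> \<open>Otherwise these 500 sources alone would cost at least 500/100 = 5, more than
    \<open>2 + 2 * sqrt 2\<close>.\<close>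
  have heavy: "\<exists>s\<in>A. d s < 1/100" if A: "A \<subseteq> {..<1004}" "card A = 500" for A
  proof (rule ccontr)
    assume "\<not> ?thesis"
    then have "1/100 \<le> d s" if "s \<in> A" for s using that by force
    then have "of_nat (card A) * (1/100) \<le> sum d A" by (rule sum_bounded_below)
    moreover have "sum d A \<le> sum d {..<1004}" using A d0 by (intro sum_mono2) auto
    moreover have "sum h ?W \<ge> 0" using h0 by (intro sum_nonneg)
    ultimately show False using bound sqrt2 A(2) by simp
  qed
  obtain s where s: "s \<in> {4..<504}" "d s < 1/100" using heavy[of "{4..<504}"] by (auto simp: subset_eq)
  obtain s' where s': "s' \<in> {504..<1004}" "d s' < 1/100" using heavy[of "{504..<1004}"] by (auto simp: subset_eq)
  have sink: "emb L (Sink 0) = \<i>" using L unfolding is_layout_def by auto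
  have near: "cmod (1 - emb L (par s)) < 1/100" "cmod (-1 - emb L (par s')) < 1/100"
    using s s' unfolding d_def by auto
  have len: "cmod (1 - \<i>) = sqrt 2" "cmod (-1 - \<i>) = sqrt 2" by (simp_all add: cmod_def)
  have "1 < sqrt 2" by simp
  \<comment> \<open>The route from the corner via the nearby parent to \<open>\<i>\<close> is at
    least as long as the side, \<open>sqrt 2\<close>.\<close>
  have hs: "h (par s) \<ge> sqrt 2 - 1/100" "h (par s') \<ge> sqrt 2 - 1/100"
    using near len norm_triangle_ineq[of "1 - emb L (par s)" "emb L (par s) - \<i>"]
      norm_triangle_ineq[of "-1 - emb L (par s')" "emb L (par s') - \<i>"] unfolding h_def by simp_all
  then have "h (par s) > 0" "h (par s') > 0" using \<open>1 < sqrt 2\<close> by linarith+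
  then have "par s \<noteq> Sink 0" "par s' \<noteq> Sink 0" using sink unfolding h_def by auto
  have "par s \<noteq> par s'"
    using near norm_triangle_ineq4[of "1 - emb L (par s)" "-1 - emb L (par s')"] by auto
  \<comment> \<open>Vertices that are already paid for or are the sink: using them costs no additional edge.\<close>
  define free where "free = {Sink 0, par s, par s'}"
  define w where "w f = (if f \<in> free then 0 else h f)" for f
  have w0: "w f \<ge> 0" for f using h0 by (simp add: w_def)
  \<comment> \<open>The remainder is \<open>2 + 2 * sqrt 2 - 2 * (sqrt 2 - 1/100)\<close>. As
    \<open>w\<close> is summed over a set, a shared parent is charged once.\<close>
  have budget: "d 0 + d 1 + d 2 + d 3 + sum w {par 1, par 2, par 3} \<le> 202/100"
  proof -
    have "sum d {0, 1, 2, 3} \<le> sum d {..<1004}" using d0 by (intro sum_mono2) auto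
    moreover have "sum w {par 1, par 2, par 3} = sum h ({par 1, par 2, par 3} - free)"
      by (rule sum.mono_neutral_cong_right) (auto simp: w_def)
    moreover have "sum h ({par 1, par 2, par 3} - free) + sum h {par s, par s'} = sum h (({par 1, par 2, par 3} - free) \<union> {par s, par s'})"
      by (rule sum.union_disjoint[symmetric]) (auto simp: free_def)
    moreover have "sum h (({par 1, par 2, par 3} - free) \<union> {par s, par s'}) \<le> sum h ?W"
      using h0 s s' \<open>par s \<noteq> Sink 0\<close> \<open>par s' \<noteq> Sink 0\<close> by (intro sum_mono2) (auto simp: free_def)
    moreover have "sum h {par s, par s'} = h (par s) + h (par s')" using \<open>par s \<noteq> par s'\<close> by simp
    moreover have "sum d {0, 1, 2, 3} = d 0 + d 1 + d 2 + d 3" by simp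
    ultimately show ?thesis using bound hs by linarith
  qed
  \<comment> \<open>Vertices in \<open>free\<close> lie within 1/100 of a corner, which lowers the
    bounds 7/10 and 1 by 1/100.\<close>
  have apart: "69/100 \<le> cmod (src_pos 1 - emb L f)" "69/100 \<le> cmod (src_pos 2 - emb L f)"
    "99/100 \<le> cmod (src_pos 3 - emb L f)" if "f \<in> free" for f
  proof -
    have "\<exists>q\<in>{1, -1, \<i>}. cmod (q - emb L f) \<le> 1/100"
      using that near sink unfolding free_def by auto
    then obtain q where q: "q \<in> {1, -1, \<i>}" "cmod (q - emb L f) \<le> 1/100" by blast
    have "cmod (x - q) - 1/100 \<le> cmod (x - emb L f)" for x
      using norm_triangle_ineq4[of "x - emb L f" "q - emb L f"] q(2) by simp
    from this[of "src_pos 1"] this[of "src_pos 2"] this[of "src_pos 3"] corner_dist_ge[OF q(1)]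
    show "69/100 \<le> cmod (src_pos 1 - emb L f)" "69/100 \<le> cmod (src_pos 2 - emb L f)"
      "99/100 \<le> cmod (src_pos 3 - emb L f)" by linarith+
  qed
  have single: "69/100 \<le> d 1 + w (par 1)" "69/100 \<le> d 2 + w (par 2)" "99/100 \<le> d 3 + w (par 3)"
    using star_ge(1)[of "emb L (par 1)"] star_ge(2)[of "emb L (par 2)"] star_ge(3)[of "emb L (par 3)"]
      apart(1)[of "par 1"] apart(2)[of "par 2"] apart(3)[of "par 3"]
    by (auto simp: d_def h_def w_def simp del: src_pos_simps)
  have pair: "par 1 = par 2 \<Longrightarrow> 1366/1000 \<le> d 1 + d 2 + w (par 1)"
    "par 1 = par 3 \<Longrightarrow> 1366/1000 \<le> d 1 + d 3 + w (par 1)"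
    "par 2 = par 3 \<Longrightarrow> 1366/1000 \<le> d 2 + d 3 + w (par 2)"
    using star_ge(4,5)[of "emb L (par 1)"] star_ge(6)[of "emb L (par 2)"]
      apart(1)[of "par 1"] apart(2)[of "par 2"] apart(3)[of "par 3"]
    by (auto simp: d_def h_def w_def simp del: src_pos_simps)
  have eq: "par 2 = par 1 \<and> par 3 = par 1"
  proof (rule ccontr)
    assume "\<not> ?thesis"
    then consider "par 1 = par 2" "par 2 \<noteq> par 3" | "par 1 = par 3" "par 2 \<noteq> par 3"
      | "par 2 = par 3" "par 1 \<noteq> par 2" | "par 1 \<noteq> par 2" "par 1 \<noteq> par 3" "par 2 \<noteq> par 3" by metis
    then show False
      by cases (use budget single pair d0[of 0] in \<open>simp_all add: sum.insert_if\<close>)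
  qed
  \<comment> \<open>Attaching all three midpoints to a vertex near a corner costs at least
    237/100.\<close>
  have nfree: "par 1 \<notin> free"
  proof
    assume "par 1 \<in> free"
    from apart[OF this] eq have "69/100 \<le> d 1" "69/100 \<le> d 2" "99/100 \<le> d 3"
      unfolding d_def by (simp_all del: src_pos_simps)
    then show False using budget eq d0[of 0] w0[of "par 1"] by simp
  qed
  \<comment> \<open>A star that also serves source 0 costs at least 225/100, above the
    budget.\<close>
  have ne0: "par 0 \<noteq> par 1"
    using budget star_ge(7)[of "emb L (par 1)"] eq nfree unfolding d_def w_def h_def
    by (auto simp del: src_pos_simps)
  obtain i where i: "par 1 = Steiner i" using par(2)[of 1] nfree by (auto simp: free_def)
  have sv: "single_valued (edges L)" and sub: "edges L \<subseteq> verts L \<times> verts L"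
    using L unfolding is_layout_def rooted_forest_def by auto
  have child: "Source k \<in> children L (Steiner i) \<longleftrightarrow> par k = Steiner i" if "k < 1004" for k
    using par(1)[OF that] single_valuedD[OF sv] unfolding children_def by auto
  show ?thesis
  proof (rule that[of i s s'])
    show "Steiner i \<in> verts L" using par(1)[of 1] sub i by auto
  qed (use eq i ne0 nfree s s' child in \<open>auto simp: free_def\<close>)
qed

section \<open>A layout of cost at most \<open>2 + 2 * sqrt 2\<close>\<close>

fun opt_parent :: "node \<Rightarrow> node" where
  "opt_parent (Source s) = (if s = 0 then Sink 0 else if s < 4 then Steiner 0
     else if s < 504 then Steiner 1 else Steiner 2)"
| "opt_parent (Steiner j) = Sink 0"
| "opt_parent (Sink j) = Sink 0"

text \<open>\<open>Steiner 1\<close> and \<open>Steiner 2\<close> sit on the crowded corners, so the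
  1000 sources there connect for free; \<open>Steiner 0\<close> has distance 1/2 from each midpoint
  and from the sink.\<close>

fun opt_emb :: "node \<Rightarrow> complex" where
  "opt_emb (Source s) = src_pos s"
| "opt_emb (Steiner j) = (if j = 0 then \<i> / 2 else if j = 1 then 1 else -1)"
| "opt_emb (Sink j) = \<i>"

definition opt_layout :: layout where
  "opt_layout = \<lparr>verts = Source ` {..<1004} \<union> Steiner ` {..2} \<union> {Sink 0},
     edges = (\<lambda>v. (v, opt_parent v)) ` (Source ` {..<1004} \<union> Steiner ` {..2}), emb = opt_emb\<rparr>"

lemma opt_verts_iff:
  "Source s \<in> verts opt_layout \<longleftrightarrow> s < 1004" "Steiner j \<in> verts opt_layout \<longleftrightarrow> j \<le> 2"
  "Sink t \<in> verts opt_layout \<longleftrightarrow> t = 0"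
  by (auto simp: opt_layout_def)

lemma opt_edges_iff:
  "(Source s, v) \<in> edges opt_layout \<longleftrightarrow> s < 1004 \<and> v = opt_parent (Source s)"
  "(Steiner j, v) \<in> edges opt_layout \<longleftrightarrow> j \<le> 2 \<and> v = Sink 0"
  "(Sink t, v) \<notin> edges opt_layout"
  by (auto simp: opt_layout_def simp del: opt_parent.simps(1))

text \<open>The function \<open>level\<close> increases strictly along edges, which yields both
  acyclicity and height at most 2.\<close>

lemma is_layout_opt: "is_layout inst opt_layout"
proof -
  define level where "level v = (case v of Source _ \<Rightarrow> 0 | Steiner _ \<Rightarrow> 1 | Sink _ \<Rightarrow> (2::nat))" for v
  let ?E = "edges opt_layout" and ?V = "verts opt_layout"
  have level: "level u < level v" if "(u, v) \<in> ?E" for u v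
    using that by (cases u) (auto simp: opt_edges_iff level_def)
  then have acyc: "acyclic ?E"
    by (intro wf_acyclic wf_subset[OF wf_measure[of level]]) auto
  have "n + level u \<le> level v" if "(u, v) \<in> ?E ^^ n" for u v n
    using that
  proof (induction n arbitrary: v)
    case (Suc n)
    then obtain z where "(u, z) \<in> ?E ^^ n" "(z, v) \<in> ?E" by auto
    then show ?case using Suc.IH level by fastforce
  qed simp
  moreover have "level v \<le> 2" for v by (simp add: level_def split: node.split)
  ultimately have "n \<le> 2" if "(u, v) \<in> ?E ^^ n" for u v n using that by (meson add_leD1 le_trans)
  moreover have "finite ?E" by (simp add: opt_layout_def)
  moreover have "(v, v) \<in> ?E ^^ 0" for v by simp
  ultimately have ht: "node_height opt_layout v \<le> 2" for v
    unfolding node_height_def using finite_path_lengths[OF _ acyc, of v]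
    by (intro Max.boundedI) blast+
  have cap: "[\<infinity>, \<infinity>, \<infinity>] ! k = (\<infinity> :: enat)" if "k \<le> 2" for k
    using that by (auto simp: le_Suc_eq numeral_2_eq_2)
  have forest: "rooted_forest ?V ?E"
    unfolding rooted_forest_def
  proof (intro conjI acyc)
    have "u \<in> ?V \<and> v \<in> ?V" if "(u, v) \<in> ?E" for u v
      using that by (cases u) (auto simp: opt_edges_iff opt_verts_iff)
    then show "?E \<subseteq> ?V \<times> ?V" by (simp add: subset_iff)
    have "v = v'" if "(u, v) \<in> ?E" "(u, v') \<in> ?E" for u v v'
      using that by (cases u) (simp_all only: opt_edges_iff)
    then show "single_valued ?E" by (rule single_valuedI)
  qed (simp add: opt_layout_def)
  \<comment> \<open>Every Steiner vertex needs a child so as not to be a leaf, and the sink needs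
    one for the same reason.\<close>
  have E: "(Source 1, Steiner 0) \<in> ?E" "(Source 4, Steiner 1) \<in> ?E" "(Source 504, Steiner 2) \<in> ?E"
    "(Source 0, Sink 0) \<in> ?E"
    by (simp_all add: opt_edges_iff)
  have leaf: "v \<in> leaves opt_layout \<longleftrightarrow> v \<in> Source ` {..<1004}" for v
  proof (cases v)
    case (Source s)
    have "(u, Source s) \<notin> ?E" for u using level[of u "Source s"] by (auto simp: level_def)
    then show ?thesis using Source by (auto simp: leaves_def opt_verts_iff)
  next
    case (Sink t)
    then show ?thesis using E(4) by (auto simp: leaves_def opt_verts_iff)
  next
    case (Steiner j)
    have "j = 0 \<or> j = 1 \<or> j = 2 \<or> j > 2" by linarith
    then have "Steiner j \<notin> ?V \<or> (\<exists>u. (u, Steiner j) \<in> ?E)" using E(1-3) opt_verts_iff(2)[of j] by auto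
    then show ?thesis using Steiner by (auto simp: leaves_def)
  qed
  have root: "v \<in> roots opt_layout \<longleftrightarrow> v = Sink 0" for v
    by (cases v) (auto simp: roots_def opt_edges_iff opt_verts_iff)
  have "v \<in> range Steiner" if "v \<in> ?V" "v \<notin> Source ` {..<1004}" "v \<noteq> Sink 0" for v
    using that by (cases v) (auto simp: opt_verts_iff)
  then have "?V - leaves opt_layout - roots opt_layout \<subseteq> range Steiner"
    using leaf root by blast
  moreover have "leaves opt_layout = Source ` {..<1004}" "roots opt_layout \<subseteq> {Sink 0}"
    using leaf root by blast+
  moreover have "emb opt_layout = opt_emb" by (simp add: opt_layout_def)
  ultimately show ?thesis
    unfolding is_layout_def using forest ht cap by (simp add: numeral_2_eq_2)
qed

lemma cost_opt: "layout_cost inst opt_layout \<le> 2 + 2 * sqrt 2"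
proof -
  let ?U = "Source ` {..<1004} \<union> Steiner ` {..2::nat}"
  let ?c = "\<lambda>v. cmod (opt_emb v - opt_emb (opt_parent v))"
  \<comment> \<open>The load factor \<open>powr 0\<close> is 0 or 1, so dropping it gives an upper
    bound without computing any load.\<close>
  have "layout_cost inst opt_layout \<le> (\<Sum>(u, v)\<in>edges opt_layout. cmod (opt_emb u - opt_emb v))"
    unfolding layout_cost_def by (intro sum_mono) (auto simp: opt_layout_def)
  also have "\<dots> = sum ?c ?U"
    by (simp add: opt_layout_def, subst sum.reindex) (auto simp: inj_on_def)
  also have "\<dots> = (\<Sum>s<1004. ?c (Source s)) + (\<Sum>j\<le>2. ?c (Steiner j))"
    by (subst sum.union_disjoint) (auto simp: sum.reindex inj_on_def)
  \<comment> \<open>All sources other than the midpoints coincide with their parents.\<close>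
  also have "(\<Sum>s<1004. ?c (Source s)) = (\<Sum>s\<in>{1, 2, 3}. ?c (Source s))"
    by (rule sum.mono_neutral_right) (auto simp: src_pos_def)
  also have "\<dots> = 3/2"
  proof -
    have "src_pos 1 - \<i> / 2 = of_real (1/2)" "src_pos 2 - \<i> / 2 = of_real (-1/2)"
      by (simp_all add: complex_eq_iff)
    then have "cmod (src_pos 1 - \<i> / 2) = 1/2" "cmod (src_pos 2 - \<i> / 2) = 1/2"
      by (simp_all only: norm_of_real)
    moreover have "cmod (src_pos 3 - \<i> / 2) = 1/2" by (simp add: norm_divide)
    ultimately show ?thesis by (simp del: src_pos_simps)
  qed
  also have "(\<Sum>j\<le>2. ?c (Steiner j)) = 1/2 + 2 * sqrt 2"
  proof -
    have "cmod (1 - \<i>) = sqrt 2" "cmod (-1 - \<i>) = sqrt 2" "cmod (\<i> / 2 - \<i>) = 1/2"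
      by (simp_all add: cmod_def power2_eq_square real_sqrt_divide)
    then show ?thesis by (simp add: numeral_2_eq_2)
  qed
  finally show ?thesis by simp
qed

theorem lemma28:
  "\<exists>(I :: flamecast) t.
     valid_instance I \<and> convex_instance I \<and>
     sinks I = {t} \<and> capacities I = [\<infinity>, \<infinity>, \<infinity>] \<and> alpha I = 0 \<and>
     (\<forall>L. min_cost_layout I L \<longrightarrow>
        (\<exists>i. Steiner i \<in> verts L \<and>
             (\<forall>xs. cyclic_ordering I xs \<longrightarrow> \<not> k_consecutive 2 xs L (Steiner i))))"
proof (rule exI[of _ inst], rule exI[of _ 0], intro conjI allI impI)
  show "valid_instance inst" by (simp add: valid_instance_def)
  show "convex_instance inst"
    unfolding convex_instance_def hull_inst frontier_triangle using src_pos_in_sides by simp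
  show "sinks inst = {0}" "capacities inst = [\<infinity>, \<infinity>, \<infinity>]" "alpha inst = 0" by simp_all
  fix L assume "min_cost_layout inst L"
  then have L: "is_layout inst L" and "layout_cost inst L \<le> layout_cost inst opt_layout"
    using is_layout_opt unfolding min_cost_layout_def is_arg_min_def by (auto simp: not_less)
  then have "layout_cost inst L \<le> 2 + 2 * sqrt 2" using cost_opt by linarith
  then obtain i s s' where "Steiner i \<in> verts L"
    "Source 1 \<in> children L (Steiner i)" "Source 2 \<in> children L (Steiner i)" "Source 3 \<in> children L (Steiner i)"
    "Source 0 \<notin> children L (Steiner i)"
    "s \<in> {4..<504}" "Source s \<notin> children L (Steiner i)" "s' \<in> {504..<1004}" "Source s' \<notin> children L (Steiner i)"
    using cheap_layout_structure[OF L] by blast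
  then show "\<exists>i. Steiner i \<in> verts L \<and> (\<forall>xs. cyclic_ordering inst xs \<longrightarrow> \<not> k_consecutive 2 xs L (Steiner i))"
    using not_2_consecutive by blast
qed

end
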